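(* Let $(H,K,E)$ be an $\varepsilon$-factorization of a simple graph $G$ with vertex ordering $V(G)=\{v_1,\dots,v_n\}$. Then the following holds: \begin{enumerate} \item if $(i,j)\in\mathrm{Good}\cap\mathcal A(G)$, then there is exactly one $H$-then-$K$ path from $v_i$ to $v_j$; \item if $(i,j)\in\mathrm{Good}\cap\mathcal Z(G)$, then there is no $H$-then-$K$ path from $v_i$ to $v_j$. \end{enumerate} Thus the entrywise witness condition (exactly one $H$-then-$K$ path at each entry of $\mathcal A(G)$ and none at each entry of $\mathcal Z(G)$) can fail only on entries $(i,j)$ with $E_{ij}=1$.
   Context: All graphs are finite, simple and undirected; $A(H)$ is the adjacency matrix of $H$. Let $0\le\varepsilon\le 1$. An $\varepsilon$-factorization $(H,K,E)$ of $G$ (with respect to the ordering $v_1,\dots,v_n$) consists of simple graphs $H,K$ on $V(G)$ and a matrix $E\in\{0,1\}^{n\times n}$ with at most $\varepsilon n^2$ nonzero entries such that $(A(H)A(K))_{ij}=A(G)_{ij}$ whenever $E_{ij}=0$. $\mathrm{Good}:=\{(i,j)\in[n]\times[n]:E_{ij}=0\}$; $\mathcal A(G):=\{(i,j)\in[n]\times[n]:A(G)_{ij}=1\}$; $\mathcal Z(G):=\{(i,j)\in[n]\times[n]:A(G)_{ij}=0\}$ (including diagonal entries). An $H$-then-$K$ path from $v_i$ to $v_j$ is a two-step walk $v_i\to v_\ell\to v_j$ with $v_iv_\ell\in E(H)$ and $v_\ell v_j\in E(K)$ (possibly $i=j$); such paths are counted by their middle vertex $v_\ell$, and an edge lying in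 both $H$ and $K$ may be used in either role. *)

theory Defs
  imports "Graph_Theory.Pair_Digraph" "Jordan_Normal_Form.Matrix"
begin

text \<open>
  A finite simple undirected graph is a \<^locale>\<open>pair_graph\<close>: finite vertex set, no loops, and a
  symmetric set of arcs, so that the edge \<open>xy\<close> is represented by the two arcs \<open>(x, y)\<close> and \<open>(y, x)\<close>.

  A vertex ordering of a graph on \<open>n\<close> vertices is a bijection \<open>v\<close> from \<open>{..<n}\<close> to the vertex set.
  Indices are 0-based, as in \<^typ>\<open>'a mat\<close>, so \<open>[n]\<close> is \<open>{..<n}\<close>.
\<close>

definition vertex_ordering :: "'v pair_pre_digraph \<Rightarrow> nat \<Rightarrow> (nat \<Rightarrow> 'v) \<Rightarrow> bool" where
  "vertex_ordering G n v \<longleftrightarrow> bij_betw v {..<n} (pverts G)"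

definition adjacency_matrix :: "nat \<Rightarrow> (nat \<Rightarrow> 'v) \<Rightarrow> 'v pair_pre_digraph \<Rightarrow> real mat" where
  "adjacency_matrix n v G = mat n n (\<lambda>(i, j). if (v i, v j) \<in> parcs G then 1 else 0)"

definition eps_factorization ::
  "real \<Rightarrow> nat \<Rightarrow> (nat \<Rightarrow> 'v) \<Rightarrow> 'v pair_pre_digraph \<Rightarrow>
   'v pair_pre_digraph \<Rightarrow> 'v pair_pre_digraph \<Rightarrow> real mat \<Rightarrow> bool" where
  "eps_factorization \<epsilon> n v G H K E \<longleftrightarrow>
     pair_graph H \<and> pverts H = pverts G \<and>
     pair_graph K \<and> pverts K = pverts G \<and>
     E \<in> carrier_mat n n \<and>
     (\<forall>i<n. \<forall>j<n. E $$ (i, j) \<in> {0, 1}) \<and>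
     real (card {(i, j). i < n \<and> j < n \<and> E $$ (i, j) \<noteq> 0}) \<le> \<epsilon> * (real n)\<^sup>2 \<and>
     (\<forall>i<n. \<forall>j<n. E $$ (i, j) = 0 \<longrightarrow>
        (adjacency_matrix n v H * adjacency_matrix n v K) $$ (i, j) = adjacency_matrix n v G $$ (i, j))"

definition Good :: "nat \<Rightarrow> real mat \<Rightarrow> (nat \<times> nat) set" where
  "Good n E = {(i, j). i < n \<and> j < n \<and> E $$ (i, j) = 0}"

definition one_entries :: "nat \<Rightarrow> (nat \<Rightarrow> 'v) \<Rightarrow> 'v pair_pre_digraph \<Rightarrow> (nat \<times> nat) set" where
  "one_entries n v G = {(i, j). i < n \<and> j < n \<and> adjacency_matrix n v G $$ (i, j) = 1}"

definition zero_entries :: "nat \<Rightarrow> (nat \<Rightarrow> 'v) \<Rightarrow> 'v pair_pre_digraph \<Rightarrow> (nat \<times> nat) set" where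
  "zero_entries n v G = {(i, j). i < n \<and> j < n \<and> adjacency_matrix n v G $$ (i, j) = 0}"

text \<open>
  The \<open>H\<close>-then-\<open>K\<close> path \<open>x \<rightarrow> w \<rightarrow> y\<close>. For fixed endpoints (possibly equal) it is determined by its
  middle vertex \<open>w\<close>, so paths from \<open>x\<close> to \<open>y\<close> are counted by counting \<open>w\<close>.
\<close>

definition then_path ::
  "'v pair_pre_digraph \<Rightarrow> 'v pair_pre_digraph \<Rightarrow> 'v \<Rightarrow> 'v \<Rightarrow> 'v \<Rightarrow> bool" where
  "then_path H K x w y \<longleftrightarrow> (x, w) \<in> parcs H \<and> (w, y) \<in> parcs K"

definition witness_at ::
  "nat \<Rightarrow> (nat \<Rightarrow> 'v) \<Rightarrow> 'v pair_pre_digraph \<Rightarrow> 'v pair_pre_digraph \<Rightarrow> 'v pair_pre_digraph \<Rightarrow>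
   nat \<Rightarrow> nat \<Rightarrow> bool" where
  "witness_at n v G H K i j \<longleftrightarrow>
     ((i, j) \<in> one_entries n v G \<longrightarrow> (\<exists>!w. then_path H K (v i) w (v j))) \<and>
     ((i, j) \<in> zero_entries n v G \<longrightarrow> \<not> (\<exists>w. then_path H K (v i) w (v j)))"

end

theory Submission
  imports Defs
begin

text \<open>
  The \<open>(i, j)\<close> entry of \<open>A(H) A(K)\<close> counts the \<open>H\<close>-then-\<open>K\<close> paths from \<open>v i\<close> to \<open>v j\<close>: the
  summand at \<open>l\<close> is \<open>1\<close> when \<open>v l\<close> is the middle vertex of such a path and \<open>0\<close> otherwise, and every
  middle vertex is \<open>v l\<close> for exactly one \<open>l < n\<close>. At a good entry this count equals the entry of
  \<open>A(G)\<close>, so a \<open>1\<close> there means a unique path and a \<open>0\<close> means none. Hence the witness condition can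
  fail only where \<open>E\<close> is nonzero, and since \<open>E\<close> has entries in \<open>{0, 1}\<close>, only where it is \<open>1\<close>.
\<close>

text \<open>
  The path count ranges over all of \<^typ>\<open>'v\<close> and the matrix product only over the ordered
  vertices. They agree because a middle vertex is an end of an arc of \<open>H\<close>, hence a vertex of \<open>H\<close>,
  and so occurs in the ordering.
\<close>

lemma card_then_path_eq_matrix_product:
  assumes v: "vertex_ordering H n v" and H: "pair_wf_digraph H"
    and "i < n" "j < n"
  shows "real (card {w. then_path H K (v i) w (v j)}) =
           (adjacency_matrix n v H * adjacency_matrix n v K) $$ (i, j)"
proof -
  interpret pair_wf_digraph H by (rule H)
  define L where "L = {l \<in> {..<n}. then_path H K (v i) (v l) (v j)}"
  have bij: "bij_betw v {..<n} (pverts H)"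
    using v by (simp add: vertex_ordering_def)
  have "{w. then_path H K (v i) w (v j)} = v ` L"
  proof (intro equalityI subsetI)
    fix w assume w: "w \<in> {w. then_path H K (v i) w (v j)}"
    then have "w \<in> pverts H"
      by (auto simp: then_path_def dest: in_arcsD2)
    then obtain l where "l < n" "w = v l"
      using bij by (auto simp: bij_betw_def)
    with w show "w \<in> v ` L"
      by (auto simp: L_def)
  qed (auto simp: L_def)
  moreover have "inj_on v L"
    using bij by (auto simp: bij_betw_def L_def intro: inj_on_subset)
  ultimately have "card {w. then_path H K (v i) w (v j)} = card L"
    by (simp add: card_image)
  also have "real (card L) = (\<Sum>l<n. if then_path H K (v i) (v l) (v j) then 1 else 0)"
    by (simp add: L_def sum.If_cases Int_def)
  also have "\<dots> = (\<Sum>l<n. (if (v i, v l) \<in> parcs H then 1 else 0) *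
                         (if (v l, v j) \<in> parcs K then 1 else 0))"
    by (intro sum.cong) (auto simp: then_path_def)
  also have "\<dots> = (adjacency_matrix n v H * adjacency_matrix n v K) $$ (i, j)"
    using \<open>i < n\<close> \<open>j < n\<close>
    by (auto simp: adjacency_matrix_def scalar_prod_def lessThan_atLeast0 intro!: sum.cong)
  finally show ?thesis .
qed

text \<open>
  Finiteness is recorded as well, because \<^const>\<open>card\<close> of an infinite set is \<open>0\<close>: a count of
  \<open>0\<close> rules out paths only once the set of middle vertices is known to be finite.
\<close>

lemma card_then_path_eq_adjacency_entry:
  assumes "vertex_ordering G n v" and E: "eps_factorization \<epsilon> n v G H K E"
    and good: "(i, j) \<in> Good n E"
  shows "real (card {w. then_path H K (v i) w (v j)}) = adjacency_matrix n v G $$ (i, j)"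
    and "finite {w. then_path H K (v i) w (v j)}"
proof -
  have ij: "i < n" "j < n" and "E $$ (i, j) = 0"
    using good by (auto simp: Good_def)
  interpret pair_graph H
    using E by (simp add: eps_factorization_def)
  have "vertex_ordering H n v"
    using assms by (simp add: vertex_ordering_def eps_factorization_def)
  then have "real (card {w. then_path H K (v i) w (v j)}) =
               (adjacency_matrix n v H * adjacency_matrix n v K) $$ (i, j)"
    by (rule card_then_path_eq_matrix_product) (unfold_locales, fact ij(1), fact ij(2))
  also have "\<dots> = adjacency_matrix n v G $$ (i, j)"
    using E ij \<open>E $$ (i, j) = 0\<close> unfolding eps_factorization_def by blast
  finally show "real (card {w. then_path H K (v i) w (v j)}) = adjacency_matrix n v G $$ (i, j)" .
  have "{w. then_path H K (v i) w (v j)} \<subseteq> pverts H"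
    by (auto simp: then_path_def dest: in_arcsD2)
  then show "finite {w. then_path H K (v i) w (v j)}"
    by (rule finite_subset) simp
qed

theorem lemma3:
  fixes G H K :: "'v pair_pre_digraph"
    and v :: "nat \<Rightarrow> 'v" and n :: nat and \<epsilon> :: real and E :: "real mat"
  assumes "0 \<le> \<epsilon>" and "\<epsilon> \<le> 1"
    and "pair_graph G"
    and "vertex_ordering G n v"
    and "eps_factorization \<epsilon> n v G H K E"
  shows "(\<forall>i j. (i, j) \<in> Good n E \<inter> one_entries n v G \<longrightarrow>
            (\<exists>!w. then_path H K (v i) w (v j))) \<and>
         (\<forall>i j. (i, j) \<in> Good n E \<inter> zero_entries n v G \<longrightarrow>
            \<not> (\<exists>w. then_path H K (v i) w (v j))) \<and>
         (\<forall>i<n. \<forall>j<n. \<not> witness_at n v G H K i j \<longrightarrow> E $$ (i, j) = 1)"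
proof -
  note count = card_then_path_eq_adjacency_entry[OF assms(4,5)]
  have one: "\<exists>!w. then_path H K (v i) w (v j)"
    if "(i, j) \<in> Good n E" "(i, j) \<in> one_entries n v G" for i j
  proof -
    have "card {w. then_path H K (v i) w (v j)} = 1"
      using count(1)[OF that(1)] that(2) by (simp add: one_entries_def)
    then obtain u where "{w. then_path H K (v i) w (v j)} = {u}"
      by (rule card_1_singletonE)
    then show ?thesis by (auto simp: set_eq_iff)
  qed
  have zero: "\<not> (\<exists>w. then_path H K (v i) w (v j))"
    if "(i, j) \<in> Good n E" "(i, j) \<in> zero_entries n v G" for i j
    using count[OF that(1)] that(2) by (simp add: zero_entries_def)
  have "E $$ (i, j) = 1" if "i < n" "j < n" "\<not> witness_at n v G H K i j" for i j
  proof (rule ccontr)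
    assume "E $$ (i, j) \<noteq> 1"
    moreover have "E $$ (i, j) \<in> {0, 1}"
      using assms(5) that(1,2) unfolding eps_factorization_def by blast
    ultimately have "(i, j) \<in> Good n E"
      using that(1,2) by (simp add: Good_def)
    then show False
      using one zero that(3) by (simp add: witness_at_def)
  qed
  with one zero show ?thesis by blast
qed

end
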